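(* Assume that splay trees have the regular access property: there is a constant $k$ such that, for every initial tree, if $c_1+\cdots+c_m$ is the total cost of a sequence of $m$ splay operations and $c'_1+\cdots+c'_{m+e}$ is the cost of performing the same sequence of splay operations augmented with $e$ extra splays inserted anywhere, then $c_1+\cdots+c_m\le k\,(c'_1+\cdots+c'_{m+e})$. Consider a sequence of $m$ queries to a splay tree $S$ with $n+2$ keys, and suppose that a similar optimal binary search tree $T$ (in the cursor model) processes the same query sequence using $R$ rotations and $M$ cursor movements. Then the total number of operations performed by $S$ is $O(n+R+M)$.
   Context: Cursor model of binary search trees: there is a cursor at a node; allowed operations are comparing the key at the cursor with the searched value (cost $0$), moving the cursor to the left child, right child or parent (cost $1$), and rotating the node at the cursor upwards (cost $1$); a search starts with the cursor at the root, must compare equal with the searched key at some point, and must return the cursor to the root at the end; each node may hold a constant amount of extra information. The optimal tree $T$ is chosen offline, knowing the whole query sequence. All queries are successful (for keys present in the tree). The splay tree $S$ answers each query for key $x$ by splaying $x$: repeatedly applying Zig (if the parent of $x$ is the root, rotate $x$ over it), ZigZig (if $x$ and its parent are both left or both right children, rotate the parent over the grandparent then $x$ over its parent) or ZigZag (otherwise rotate $x$ twice) until $x$ is the root; the cost of a splay is the number of cursor moves, i.e., the depth of $x$ in $S$. "Similar" means that $S$ and the tree used for comparison start from the same initial configuration; the $n+2$ keys of $S$ consist of the $n$ keys of $T$ together with two extra keys, one smaller and one larger than all others. *)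

theory Defs
  imports Complex_Main "HOL-Library.Tree" "HOL-Library.Sublist"
begin

text \<open>A context step records how we got to the current subtree:
  CL a r: we went to the left child of node (_, a, r);
  CR l a: we went to the right child of node (l, a, _).
  A configuration is (path from cursor up to root, subtree at the cursor);
  the head of the path is the step to the parent.\<close>

datatype 'a ctx = CL 'a "'a tree" | CR "'a tree" 'a

type_synonym 'a config = "'a ctx list \<times> 'a tree"

fun plug :: "'a ctx list \<Rightarrow> 'a tree \<Rightarrow> 'a tree" where
  "plug [] t = t"
| "plug (CL a r # ps) t = plug ps (Node t a r)"
| "plug (CR l a # ps) t = plug ps (Node l a t)"

fun descend :: "'a::linorder \<Rightarrow> 'a ctx list \<Rightarrow> 'a tree \<Rightarrow> 'a config" where
  "descend x ps Leaf = (ps, Leaf)"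
| "descend x ps (Node l a r) =
     (if x < a then descend x (CL a r # ps) l
      else if a < x then descend x (CR l a # ps) r
      else (ps, Node l a r))"

fun zig :: "'a ctx \<Rightarrow> 'a tree \<Rightarrow> 'a tree" where
  "zig (CL p C) (Node A x B) = Node A x (Node B p C)"
| "zig (CR C p) (Node A x B) = Node (Node C p A) x B"
| "zig d Leaf = Leaf"

text \<open>One double step: d1 is the step to the parent, d2 the step to the
  grandparent. ZigZig (same directions): rotate parent over grandparent, then
  x over parent. ZigZag (opposite directions): rotate x twice.\<close>
fun zigzx :: "'a ctx \<Rightarrow> 'a ctx \<Rightarrow> 'a tree \<Rightarrow> 'a tree" where
  "zigzx (CL p C) (CL g D) (Node A x B) = Node A x (Node B p (Node C g D))"
| "zigzx (CR C p) (CR D g) (Node A x B) = Node (Node (Node D g C) p A) x B"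
| "zigzx (CR C p) (CL g D) (Node A x B) = Node (Node C p A) x (Node B g D)"
| "zigzx (CL p C) (CR D g) (Node A x B) = Node (Node D g A) x (Node B p C)"
| "zigzx d1 d2 Leaf = Leaf"

fun splay_up :: "'a ctx list \<Rightarrow> 'a tree \<Rightarrow> 'a tree" where
  "splay_up [] t = t"
| "splay_up [d] t = zig d t"
| "splay_up (d1 # d2 # ps) t = splay_up ps (zigzx d1 d2 t)"

definition splay :: "'a::linorder \<Rightarrow> 'a tree \<Rightarrow> 'a tree" where
  "splay x t = (case descend x [] t of (ps, s) \<Rightarrow> splay_up ps s)"

definition splay_cost :: "'a::linorder \<Rightarrow> 'a tree \<Rightarrow> nat" where
  "splay_cost x t = length (fst (descend x [] t))"

fun splay_seq_cost :: "'a::linorder tree \<Rightarrow> 'a list \<Rightarrow> nat" where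
  "splay_seq_cost t [] = 0"
| "splay_seq_cost t (x # xs) = splay_cost x t + splay_seq_cost (splay x t) xs"

definition regular_access_property :: "'a::linorder itself \<Rightarrow> bool" where
  "regular_access_property _ \<longleftrightarrow>
     (\<exists>k::real. \<forall>(t::'a tree) xs ys.
        bst t \<longrightarrow> set ys \<subseteq> set_tree t \<longrightarrow> subseq xs ys \<longrightarrow>
        real (splay_seq_cost t xs) \<le> k * real (splay_seq_cost t ys))"

datatype cop = Cmp | GoLeft | GoRight | GoParent | RotUp

fun cstep :: "cop \<Rightarrow> 'a config \<Rightarrow> 'a config option" where
  "cstep Cmp c = Some c"
| "cstep GoLeft (ps, Node l a r) = (if l = Leaf then None else Some (CL a r # ps, l))"
| "cstep GoRight (ps, Node l a r) = (if r = Leaf then None else Some (CR l a # ps, r))"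
| "cstep GoParent (CL a r # ps, t) = Some (ps, Node t a r)"
| "cstep GoParent (CR l a # ps, t) = Some (ps, Node l a t)"
| "cstep RotUp (CL p C # ps, Node A x B) = Some (ps, Node A x (Node B p C))"
| "cstep RotUp (CR C p # ps, Node A x B) = Some (ps, Node (Node C p A) x B)"
| "cstep _ _ = None"

fun cursor_key :: "'a config \<Rightarrow> 'a option" where
  "cursor_key (ps, Node l a r) = Some a"
| "cursor_key (ps, Leaf) = None"

fun crun :: "'a \<Rightarrow> cop list \<Rightarrow> 'a config \<Rightarrow> ('a config \<times> bool) option" where
  "crun x [] c = Some (c, False)"
| "crun x (o1 # os) c =
     (case cstep o1 c of
        None \<Rightarrow> None
      | Some c' \<Rightarrow> (case crun x os c' of
            None \<Rightarrow> None
          | Some (c'', f) \<Rightarrow> Some (c'', f \<or> (o1 = Cmp \<and> cursor_key c = Some x))))"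

definition valid_search :: "'a \<Rightarrow> 'a tree \<Rightarrow> cop list \<Rightarrow> 'a tree \<Rightarrow> bool" where
  "valid_search x t os t' \<longleftrightarrow> crun x os ([], t) = Some (([], t'), True)"

fun valid_exec :: "'a tree \<Rightarrow> 'a list \<Rightarrow> cop list list \<Rightarrow> bool" where
  "valid_exec t [] [] = True"
| "valid_exec t (x # xs) (os # oss) = (\<exists>t'. valid_search x t os t' \<and> valid_exec t' xs oss)"
| "valid_exec t _ _ = False"

definition num_rotations :: "cop list list \<Rightarrow> nat" where
  "num_rotations oss = length (filter (\<lambda>o1. o1 = RotUp) (concat oss))"

definition num_moves :: "cop list list \<Rightarrow> nat" where
  "num_moves oss = length (filter (\<lambda>o1. o1 \<in> {GoLeft, GoRight, GoParent}) (concat oss))"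

fun add_min :: "'a \<Rightarrow> 'a tree \<Rightarrow> 'a tree" where
  "add_min lo Leaf = Node Leaf lo Leaf"
| "add_min lo (Node l a r) = Node (add_min lo l) a r"

fun add_max :: "'a \<Rightarrow> 'a tree \<Rightarrow> 'a tree" where
  "add_max hi Leaf = Node Leaf hi Leaf"
| "add_max hi (Node l a r) = Node l a (add_max hi r)"

definition similar_splay_tree :: "'a tree \<Rightarrow> 'a \<Rightarrow> 'a \<Rightarrow> 'a tree" where
  "similar_splay_tree T lo hi = add_min lo (add_max hi T)"

end

theory Submission
  imports Defs
begin

text \<open>
  A splay tree can follow the cursor of \<open>T\<close> at constant cost per operation if extra splays may be
  inserted. The tree kept for a cursor configuration is \<open>T\<close> seen from the cursor: the cursor node
  is the root, its left subtree hangs off the nearest smaller ancestor, behind which come the farther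
  smaller ancestors, and likewise on the right; the two extra keys stand in for missing ancestors.
  Moving down is then a single ZigZag splay, and moving up or rotating is a sequence of three splays
  among the four nodes nearest to the root. Comparing is a free splay of the root, so the query
  sequence is a subsequence of the simulating splays. Three splays turn the initial tree into such a
  tree for some other search tree on the keys of \<open>T\<close>, which \<open>O(n)\<close> simulated cursor operations
  transform into \<open>T\<close>. The regular access property then removes the extra splays.
\<close>

section \<open>Splaying\<close>

lemma inorder_plug_cong: "inorder s = inorder t \<Longrightarrow> inorder (plug ps s) = inorder (plug ps t)"
  by (induction ps s arbitrary: t rule: plug.induct) auto

lemma plug_descend: "(case descend x ps t of (qs, s) \<Rightarrow> plug qs s) = plug ps t"
  by (induction x ps t rule: descend.induct) auto

text \<open>Each double step keeps the inorder of the two context steps it consumes, and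
  \<open>inorder_plug_cong\<close> carries this through the rest of the path.\<close>

lemma inorder_splay_up: "t \<noteq> Leaf \<Longrightarrow> inorder (splay_up ps t) = inorder (plug ps t)"
proof (induction ps t rule: splay_up.induct)
  case (2 d t)
  then show ?case by (cases d; cases t) auto
next
  case (3 d1 d2 ps t)
  then obtain A x B where t: "t = Node A x B" by (cases t) auto
  have "zigzx d1 d2 t \<noteq> Leaf" "inorder (zigzx d1 d2 t) = inorder (plug [d1, d2] t)"
    by (cases d1; cases d2; simp add: t)+
  then have "inorder (splay_up (d1 # d2 # ps) t) = inorder (plug ps (plug [d1, d2] t))"
    using 3(1) inorder_plug_cong[of "zigzx d1 d2 t" "plug [d1, d2] t" ps] by simp
  also have "plug ps (plug [d1, d2] t) = plug (d1 # d2 # ps) t"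
    by (cases d1; cases d2) auto
  finally show ?case .
qed auto

lemma root_splay_up: "\<exists>A' B'. splay_up ps (Node A x B) = Node A' x B'"
proof (induction ps "Node A x B" arbitrary: A B rule: splay_up.induct)
  case (2 d)
  then show ?case by (cases d) auto
next
  case (3 d1 d2 ps)
  have "\<exists>A' B'. zigzx d1 d2 (Node A x B) = Node A' x B'"
    by (cases d1; cases d2) auto
  then show ?case using 3 by auto
qed auto

lemma snd_descend: "bst t \<Longrightarrow> x \<in> set_tree t \<Longrightarrow> \<exists>A B. snd (descend x ps t) = Node A x B"
  by (induction x ps t rule: descend.induct) auto

lemma length_descend: "length (fst (descend x ps t)) \<le> length ps + size t"
proof (induction x ps t rule: descend.induct)
  case (2 x ps l a r)
  then show ?case by (cases x a rule: linorder_cases) (auto intro: order_trans)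
qed auto

text \<open>Descending only pushes steps onto the front of the path, so steps already taken survive
  as a suffix. This exposes the old root as the last step of a splay.\<close>

lemma descend_append:
  "descend x (ps @ qs) t = (fst (descend x ps t) @ qs, snd (descend x ps t))"
proof (induction t arbitrary: ps)
  case (Node l a r)
  show ?case
    using Node(1)[of "CL a r # ps"] Node(2)[of "CR l a # ps"]
    by (cases x a rule: linorder_cases) auto
qed auto

lemma splay_cost_le_size: "splay_cost x t \<le> size t"
  using length_descend[of x "[]" t] by (simp add: splay_cost_def)

lemma splay_member:
  assumes "bst t" "x \<in> set_tree t"
  shows "\<exists>A B. splay x t = Node A x B" "inorder (splay x t) = inorder t"
proof -
  obtain ps A B where d: "descend x [] t = (ps, Node A x B)"
    using snd_descend[OF assms, of "[]"] by (metis surjective_pairing)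
  then have "plug ps (Node A x B) = t"
    using plug_descend[of x "[]" t] by simp
  then show "inorder (splay x t) = inorder t"
    using d inorder_splay_up[of "Node A x B" ps] by (simp add: splay_def)
  show "\<exists>A B. splay x t = Node A x B"
    using d root_splay_up by (simp add: splay_def)
qed

section \<open>Sequences of splays and their total cost\<close>

lemma splay_seq_cost_append:
  "splay_seq_cost t (xs @ ys) = splay_seq_cost t xs + splay_seq_cost (fold splay xs t) ys"
  by (induction xs arbitrary: t) auto

lemma inorder_fold_splay:
  "bst t \<Longrightarrow> set ys \<subseteq> set_tree t \<Longrightarrow> inorder (fold splay ys t) = inorder t"
proof (induction ys arbitrary: t)
  case (Cons y ys)
  then have io: "inorder (splay y t) = inorder t"
    by (simp add: splay_member)
  then have "bst (splay y t)" "set_tree (splay y t) = set_tree t"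
    using Cons.prems by (metis bst_iff_sorted_wrt_less, metis set_inorder)
  then show ?case using Cons io by simp
qed auto

text \<open>The number \<open>n\<close> is only an upper bound, so bounds add up under
  concatenation. The membership condition is what the regular access property asks of the augmented
  sequence.\<close>

definition splays_to :: "'a::linorder tree \<Rightarrow> 'a list \<Rightarrow> nat \<Rightarrow> 'a tree \<Rightarrow> bool" where
  "splays_to t ys n t' \<longleftrightarrow>
     set ys \<subseteq> set_tree t \<and> fold splay ys t = t' \<and> splay_seq_cost t ys \<le> n"

lemma splays_to_refl: "splays_to t [] 0 t"
  by (simp add: splays_to_def)

lemma splays_to_inorder: "splays_to t ys n t' \<Longrightarrow> bst t \<Longrightarrow> inorder t' = inorder t"
  unfolding splays_to_def using inorder_fold_splay by blast

lemma splays_to_bst: "splays_to t ys n t' \<Longrightarrow> bst t \<Longrightarrow> bst t'"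
  using splays_to_inorder by (metis bst_iff_sorted_wrt_less)

lemma splays_to_trans:
  assumes "splays_to t ys n t'" "splays_to t' zs m t''" "bst t"
  shows "splays_to t (ys @ zs) (n + m) t''"
proof -
  have "set_tree t' = set_tree t"
    using assms splays_to_inorder by (metis set_inorder)
  then show ?thesis
    using assms by (auto simp: splays_to_def splay_seq_cost_append)
qed

lemma splays_to_mono: "splays_to t ys n t' \<Longrightarrow> n \<le> m \<Longrightarrow> splays_to t ys m t'"
  by (auto simp: splays_to_def)

lemma splay_once:
  assumes "bst t" "x \<in> set_tree t"
  obtains A B where "splays_to t [x] (size t) (Node A x B)"
  using splay_member[OF assms] splay_cost_le_size[of x t] assms
  by (auto simp: splays_to_def)

section \<open>The tree seen from the cursor\<close>

text \<open>Here \<open>A\<close> is the left subtree of the current node. The smaller ancestors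
  form a left spine with the nearest on top and \<open>lo\<close> at its end; to the right of each
  hangs what lies between it and the next nearer one. A \<open>CL\<close> step is skipped since it
  comes from a larger ancestor.\<close>

fun lpart :: "'a \<Rightarrow> 'a ctx list \<Rightarrow> 'a tree \<Rightarrow> 'a tree" where
  "lpart lo [] A = Node Leaf lo A"
| "lpart lo (CL a r # ps) A = lpart lo ps A"
| "lpart lo (CR l a # ps) A = Node (lpart lo ps l) a A"

fun rpart :: "'a \<Rightarrow> 'a ctx list \<Rightarrow> 'a tree \<Rightarrow> 'a tree" where
  "rpart hi [] B = Node B hi Leaf"
| "rpart hi (CL a r # ps) B = Node B a (rpart hi ps r)"
| "rpart hi (CR l a # ps) B = rpart hi ps B"

text \<open>The \<open>Leaf\<close> case is a dummy value: cursor operations never enter an empty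
  subtree.\<close>

fun finger :: "'a \<Rightarrow> 'a \<Rightarrow> 'a config \<Rightarrow> 'a tree" where
  "finger lo hi (ps, Node A x B) = Node (lpart lo ps A) x (rpart hi ps B)"
| "finger lo hi (ps, Leaf) = Leaf"

text \<open>The quantifier order matters: \<open>L\<close> and \<open>l\<close> depend on the path
  alone, so exchanging the cursor's left subtree changes only one grandchild of the root of the
  finger tree. The key \<open>lo\<close> keeps this side nonempty even for the empty path.\<close>

lemma lpart_eq_Node: "\<exists>L l. \<forall>A. lpart lo ps A = Node L l A"
  by (induction lo ps "Leaf :: 'a tree" rule: lpart.induct) auto

lemma rpart_eq_Node: "\<exists>r R. \<forall>B. rpart hi ps B = Node B r R"
  by (induction hi ps "Leaf :: 'a tree" rule: rpart.induct) auto

section \<open>Imitating single cursor operations\<close>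

lemma down_left:
  assumes "bst (Node (Node L l (Node A y B)) x R)"
  shows "splays_to (Node (Node L l (Node A y B)) x R) [y] 8 (Node (Node L l A) y (Node B x R))"
proof -
  have "l < y" "y < x" using assms by auto
  then show ?thesis by (auto simp: splays_to_def splay_def splay_cost_def)
qed

lemma down_right:
  assumes "bst (Node L x (Node (Node A y B) r R))"
  shows "splays_to (Node L x (Node (Node A y B) r R)) [y] 8 (Node (Node L x A) y (Node B r R))"
proof -
  have "x < y" "y < r" using assms by auto
  then show ?thesis by (auto simp: splays_to_def splay_def splay_cost_def)
qed

text \<open>After splaying \<open>r\<close> and \<open>l\<close>, the root is \<open>l\<close> with
  right child \<open>r\<close>, and the left subtree of \<open>r\<close> is \<open>x\<close> with
  right child \<open>a\<close>. The last splay decides: \<open>a\<close> at depth 3 for a move to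
  the parent, \<open>x\<close> at depth 2 for a rotation. The depths 2 + 3 + 3 of the first sequence
  are the source of the bound 8, used uniformly for all operations.\<close>

lemma up_from_left:
  assumes "bst (Node (Node L l A) x (Node B a (Node C r R)))"
  shows "splays_to (Node (Node L l A) x (Node B a (Node C r R))) [r, l, a] 8
           (Node (Node L l (Node A x B)) a (Node C r R))"
    and "splays_to (Node (Node L l A) x (Node B a (Node C r R))) [r, l, x] 8
           (Node (Node L l A) x (Node (Node B a C) r R))"
proof -
  have "l < x" "x < a" "a < r" "l < a" "x < r" "l < r" using assms by auto
  then show "splays_to (Node (Node L l A) x (Node B a (Node C r R))) [r, l, a] 8
           (Node (Node L l (Node A x B)) a (Node C r R))"
    and "splays_to (Node (Node L l A) x (Node B a (Node C r R))) [r, l, x] 8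
           (Node (Node L l A) x (Node (Node B a C) r R))"
    by (auto simp: splays_to_def splay_def splay_cost_def)
qed

lemma up_from_right:
  assumes "bst (Node (Node (Node L l C) a A) x (Node B r R))"
  shows "splays_to (Node (Node (Node L l C) a A) x (Node B r R)) [l, r, a] 8
           (Node (Node L l C) a (Node (Node A x B) r R))"
    and "splays_to (Node (Node (Node L l C) a A) x (Node B r R)) [l, r, x] 8
           (Node (Node L l (Node C a A)) x (Node B r R))"
proof -
  have "l < a" "a < x" "x < r" "l < x" "a < r" "l < r" using assms by auto
  then show "splays_to (Node (Node (Node L l C) a A) x (Node B r R)) [l, r, a] 8
           (Node (Node L l C) a (Node (Node A x B) r R))"
    and "splays_to (Node (Node (Node L l C) a A) x (Node B r R)) [l, r, x] 8
           (Node (Node L l (Node C a A)) x (Node B r R))"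
    by (auto simp: splays_to_def splay_def splay_cost_def)
qed

lemma cstep_not_Leaf: "cstep o1 c = Some c' \<Longrightarrow> snd c \<noteq> Leaf \<Longrightarrow> snd c' \<noteq> Leaf"
  by (induction o1 c rule: cstep.induct) (auto split: if_splits)

definition op_cost :: "cop \<Rightarrow> nat" where
  "op_cost o1 = (if o1 = Cmp then 0 else 8)"

text \<open>The clause on \<open>Cmp\<close> records where a query key enters the simulating
  sequence: a comparison is matched by splaying the root key.\<close>

lemma simulate_cstep:
  assumes "cstep o1 c = Some c'" "snd c \<noteq> Leaf" "bst (finger lo hi c)"
  shows "\<exists>ys. splays_to (finger lo hi c) ys (op_cost o1) (finger lo hi c') \<and>
           (\<forall>x. o1 = Cmp \<and> cursor_key c = Some x \<longrightarrow> x \<in> set ys)"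
proof -
  obtain ps A x B where c: "c = (ps, Node A x B)"
    using assms(2) by (metis neq_Leaf_iff prod.collapse)
  obtain L l where L: "\<And>A. lpart lo ps A = Node L l A" using lpart_eq_Node[of lo ps] by blast
  obtain r R where R: "\<And>B. rpart hi ps B = Node B r R" using rpart_eq_Node[of hi ps] by blast
  show ?thesis
  proof (cases o1)
    case Cmp
    have "splays_to (finger lo hi c) [x] 0 (finger lo hi c)"
      by (simp add: c splays_to_def splay_def splay_cost_def)
    then show ?thesis using assms(1) Cmp c by (intro exI[of _ "[x]"]) (auto simp: op_cost_def)
  next
    case GoLeft
    then obtain A1 y A2 where "A = Node A1 y A2" "c' = (CL x B # ps, A)"
      using assms(1) c by (cases A) auto
    then show ?thesis
      using assms(3) GoLeft c L down_left[of L l A1 y A2 x "rpart hi ps B"]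
      by (intro exI[of _ "[y]"]) (auto simp: op_cost_def)
  next
    case GoRight
    then obtain B1 y B2 where "B = Node B1 y B2" "c' = (CR A x # ps, B)"
      using assms(1) c by (cases B) auto
    then show ?thesis
      using assms(3) GoRight c R down_right[of "lpart lo ps A" x B1 y B2 r R]
      by (intro exI[of _ "[y]"]) (auto simp: op_cost_def)
  next
    case GoParent
    then obtain d qs where ps: "ps = d # qs" using assms(1) c by (cases ps) auto
    \<comment> \<open>The finger trees before and after the step are both expressed through the two
      sides for the parent's path \<open>qs\<close>. Their roots \<open>l'\<close> and
      \<open>r'\<close>, the cursor node and its parent are the four nodes to be rearranged.\<close>
    obtain L' l' where L': "\<And>A. lpart lo qs A = Node L' l' A" using lpart_eq_Node[of lo qs] by blast
    obtain r' R' where R': "\<And>B. rpart hi qs B = Node B r' R'" using rpart_eq_Node[of hi qs] by blast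
    show ?thesis
    proof (cases d)
      case (CL a C)
      then show ?thesis
        using assms(1,3) GoParent c ps L' R' up_from_left(1)[of L' l' A x B a C r' R']
        by (intro exI[of _ "[r', l', a]"]) (auto simp: op_cost_def)
    next
      case (CR C a)
      then show ?thesis
        using assms(1,3) GoParent c ps L' R' up_from_right(1)[of L' l' C a A x B r' R']
        by (intro exI[of _ "[l', r', a]"]) (auto simp: op_cost_def)
    qed
  next
    case RotUp
    then obtain d qs where ps: "ps = d # qs" using assms(1) c by (cases ps) auto
    obtain L' l' where L': "\<And>A. lpart lo qs A = Node L' l' A" using lpart_eq_Node[of lo qs] by blast
    obtain r' R' where R': "\<And>B. rpart hi qs B = Node B r' R'" using rpart_eq_Node[of hi qs] by blast
    show ?thesis
    proof (cases d)
      case (CL a C)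
      then show ?thesis
        using assms(1,3) RotUp c ps L' R' up_from_left(2)[of L' l' A x B a C r' R']
        by (intro exI[of _ "[r', l', x]"]) (auto simp: op_cost_def)
    next
      case (CR C a)
      then show ?thesis
        using assms(1,3) RotUp c ps L' R' up_from_right(2)[of L' l' C a A x B r' R']
        by (intro exI[of _ "[l', r', x]"]) (auto simp: op_cost_def)
    qed
  qed
qed

section \<open>Imitating whole searches and executions\<close>

lemma simulate_crun:
  assumes "crun x os c = Some (c', f)" "snd c \<noteq> Leaf" "bst (finger lo hi c)"
  shows "snd c' \<noteq> Leaf \<and>
    (\<exists>ys. splays_to (finger lo hi c) ys (sum_list (map op_cost os)) (finger lo hi c') \<and>
          (f \<longrightarrow> x \<in> set ys))"
  using assms
proof (induction os arbitrary: c f)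
  case Nil
  then show ?case using splays_to_refl by fastforce
next
  case (Cons o1 os)
  then obtain c1 f1 where c1: "cstep o1 c = Some c1" "crun x os c1 = Some (c', f1)"
    and f: "f \<longleftrightarrow> f1 \<or> o1 = Cmp \<and> cursor_key c = Some x"
    by (auto split: option.splits)
  obtain ys where ys: "splays_to (finger lo hi c) ys (op_cost o1) (finger lo hi c1)"
    "\<forall>x. o1 = Cmp \<and> cursor_key c = Some x \<longrightarrow> x \<in> set ys"
    using simulate_cstep c1(1) Cons.prems by blast
  have "snd c1 \<noteq> Leaf" "bst (finger lo hi c1)"
    using cstep_not_Leaf c1(1) splays_to_bst ys(1) Cons.prems by blast+
  then obtain zs where zs: "snd c' \<noteq> Leaf"
    "splays_to (finger lo hi c1) zs (sum_list (map op_cost os)) (finger lo hi c')"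
    "f1 \<longrightarrow> x \<in> set zs"
    using Cons.IH c1(2) by blast
  have "splays_to (finger lo hi c) (ys @ zs) (sum_list (map op_cost (o1 # os))) (finger lo hi c')"
    using splays_to_trans[OF ys(1) zs(2)] Cons.prems(3) by simp
  then show ?case using zs ys(2) f by (metis UnCI set_append)
qed

text \<open>Every search ends with the cursor back at the root, so the simulations of consecutive
  searches fit together. Each contributes a block of splays containing its query key, and one key
  chosen from each block spells out \<open>xs\<close>.\<close>

lemma simulate_exec:
  assumes "valid_exec T xs oss" "T \<noteq> Leaf" "bst (finger lo hi ([], T))"
  shows "\<exists>ys t'. splays_to (finger lo hi ([], T)) ys (sum_list (map op_cost (concat oss))) t' \<and>
           subseq xs ys"
  using assms
proof (induction T xs oss rule: valid_exec.induct)
  case (1 t)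
  then show ?case using splays_to_refl by fastforce
next
  case (2 t x xs os oss)
  then obtain t1 where t1: "crun x os ([], t) = Some (([], t1), True)" "valid_exec t1 xs oss"
    by (auto simp: valid_search_def)
  obtain ys where ys: "t1 \<noteq> Leaf" "x \<in> set ys"
    "splays_to (finger lo hi ([], t)) ys (sum_list (map op_cost os)) (finger lo hi ([], t1))"
    using simulate_crun[OF t1(1)] 2(3,4) by auto
  obtain zs t' where zs: "subseq xs zs"
    "splays_to (finger lo hi ([], t1)) zs (sum_list (map op_cost (concat oss))) t'"
    using 2(1)[of t1] t1 ys splays_to_bst[OF ys(3)] 2(4) by (auto simp: valid_search_def)
  have "subseq [x] ys"
    using ys(2) by (simp add: subseq_singleton_left)
  then have "subseq (x # xs) (ys @ zs)"
    using zs(1) list_emb_append_mono[of "(=)" "[x]" ys xs zs] by simp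
  then show ?case using splays_to_trans[OF ys(3) zs(2) 2(4)] by auto
qed auto

lemma sum_op_cost:
  "sum_list (map op_cost (concat oss)) = 8 * (num_rotations oss + num_moves oss)"
proof -
  have "sum_list (map op_cost os) =
      8 * (length (filter (\<lambda>o1. o1 = RotUp) os) +
           length (filter (\<lambda>o1. o1 \<in> {GoLeft, GoRight, GoParent}) os))" for os
  proof (induction os)
    case (Cons a os)
    then show ?case by (cases a) (auto simp: op_cost_def)
  qed simp
  then show ?thesis by (simp add: num_rotations_def num_moves_def)
qed

section \<open>Transforming one search tree into another\<close>

text \<open>Since \<open>refl\<close> holds for every \<open>n\<close>, the index is an upper bound
  on the number of operations. No searched key is involved.\<close>

inductive creach :: "nat \<Rightarrow> 'a config \<Rightarrow> 'a config \<Rightarrow> bool" where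
  refl: "creach n c c"
| step: "cstep o1 c = Some c' \<Longrightarrow> creach n c' c'' \<Longrightarrow> creach (Suc n) c c''"

lemma creach_trans: "creach n c c' \<Longrightarrow> creach m c' c'' \<Longrightarrow> creach (n + m) c c''"
proof (induction rule: creach.induct)
  case (refl n c)
  \<comment> \<open>The first run may leave its whole budget \<open>n\<close> unspent, so
    monotonicity in the index is needed here.\<close>
  have "creach m c c'' \<Longrightarrow> creach (n + m) c c''" for n m :: nat
  proof (induction rule: creach.induct)
    case (step o1 c c' m c'')
    then show ?case using creach.step by fastforce
  qed (rule creach.refl)
  then show ?case using refl .
qed (auto intro: creach.step)

lemma creach_mono: "creach n c c' \<Longrightarrow> n \<le> m \<Longrightarrow> creach m c c'"
  using creach_trans[of n c c' "m - n" c'] creach.refl by fastforce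

text \<open>Moves are undone by one opposite move. A rotation takes three operations: step down to
  the former parent, rotate it back up, and step down to the original node.\<close>

lemma cstep_reverse:
  assumes "cstep o1 c = Some c'" "snd c \<noteq> Leaf"
  shows "creach 3 c' c"
proof -
  have 1: "creach 3 c' c" if "cstep o2 c' = Some c" for o2
    using creach.step[OF that creach.refl[of 2]] by simp
  obtain ps A x B where c: "c = (ps, Node A x B)"
    using assms(2) by (metis neq_Leaf_iff prod.collapse)
  show ?thesis
  proof (cases o1)
    case Cmp
    then show ?thesis using assms(1) by (auto intro: creach.refl)
  next
    case GoLeft
    then show ?thesis using assms(1) c by (intro 1[of GoParent]) (auto split: if_splits)
  next
    case GoRight
    then show ?thesis using assms(1) c by (intro 1[of GoParent]) (auto split: if_splits)
  next
    case GoParent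
    then obtain d qs where ps: "ps = d # qs" using assms(1) c by (cases ps) auto
    show ?thesis
    proof (cases d)
      case CL
      then show ?thesis using assms(1) c GoParent ps by (intro 1[of GoLeft]) auto
    next
      case CR
      then show ?thesis using assms(1) c GoParent ps by (intro 1[of GoRight]) auto
    qed
  next
    case RotUp
    then obtain d qs where ps: "ps = d # qs" using assms(1) c by (cases ps) auto
    have 3: "creach 3 c' c"
      if "cstep o2 c' = Some c1" "cstep RotUp c1 = Some c2" "cstep o3 c2 = Some c" for o2 o3 c1 c2
      using creach.step[OF that(1) creach.step[OF that(2) creach.step[OF that(3) creach.refl[of 0]]]]
      by (simp add: numeral_3_eq_3)
    show ?thesis
    proof (cases d)
      case (CL p C)
      then show ?thesis using assms(1) c RotUp ps
        by (intro 3[of GoRight "(CR A x # qs, Node B p C)" "(qs, Node (Node A x B) p C)" GoLeft]) auto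
    next
      case (CR C p)
      then show ?thesis using assms(1) c RotUp ps
        by (intro 3[of GoLeft "(CL x B # qs, Node C p A)" "(qs, Node C p (Node A x B))" GoRight]) auto
    qed
  qed
qed

lemma creach_reverse: "creach n c c' \<Longrightarrow> snd c \<noteq> Leaf \<Longrightarrow> creach (3 * n) c' c"
proof (induction rule: creach.induct)
  case (step o1 c c' n c'')
  then have "creach (3 * n) c'' c'" "creach 3 c' c"
    using cstep_not_Leaf cstep_reverse by blast+
  from creach_trans[OF this] show ?case by (simp add: add.commute)
qed (rule creach.refl)

section \<open>Flattening a tree to a right path\<close>

definition comb :: "'a list \<Rightarrow> 'a tree" where
  "comb xs = foldr (\<lambda>a t. Node Leaf a t) xs Leaf"

lemma comb_simps [simp]: "comb [] = Leaf" "comb (a # xs) = Node Leaf a (comb xs)"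
  by (simp_all add: comb_def)

text \<open>
  Counts the operations that \<open>creach_comb\<close> below uses: a node on the right spine is entered and left
  once, and any other node needs in addition a step down and a rotation to get onto the spine.
\<close>
fun comb_cost :: "'a tree \<Rightarrow> nat" where
  "comb_cost Leaf = 0"
| "comb_cost (Node l a r) = 2 + 4 * size l + comb_cost r"

lemma comb_cost_le: "comb_cost t \<le> 4 * size t"
  by (induction t) auto

text \<open>A left child is entered and rotated up; this keeps the size but lowers
  \<open>comb_cost\<close> by 2, exactly the price paid, hence the induction on
  \<open>comb_cost\<close>. Without a left child the cursor enters the right subtree, if nonempty,
  flattens it and returns.\<close>

lemma creach_comb: "t \<noteq> Leaf \<Longrightarrow> creach (comb_cost t) (ps, t) (ps, comb (inorder t))"
proof (induction t arbitrary: ps rule: measure_induct_rule[where f = comb_cost])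
  case (less t)
  then obtain l a r where t: "t = Node l a r" by (cases t) auto
  show ?case
  proof (cases l)
    case Leaf
    show ?thesis
    proof (cases "r = Leaf")
      case True
      then show ?thesis using t Leaf by (simp add: creach.refl)
    next
      case False
      have "creach (comb_cost r) (CR l a # ps, r) (CR l a # ps, comb (inorder r))"
        using less.IH[of r] t False by simp
      moreover have "creach 1 (CR l a # ps, comb (inorder r)) (ps, Node l a (comb (inorder r)))"
        by (metis One_nat_def creach.step creach.refl cstep.simps(5))
      ultimately have "creach (comb_cost r + 1) (CR l a # ps, r) (ps, Node l a (comb (inorder r)))"
        by (rule creach_trans)
      then have "creach (Suc (comb_cost r + 1)) (ps, t) (ps, Node l a (comb (inorder r)))"
        using t False by (intro creach.step[of GoRight]) auto
      then show ?thesis using t Leaf by simp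
    qed
  next
    case (Node A y B)
    let ?s = "Node A y (Node B a r)"
    have "creach (comb_cost ?s) (ps, ?s) (ps, comb (inorder ?s))"
      using less.IH[of ?s] t Node by simp
    then have "creach (Suc (comb_cost ?s)) (CL a r # ps, l) (ps, comb (inorder ?s))"
      using Node by (intro creach.step[of RotUp]) auto
    then have "creach (Suc (Suc (comb_cost ?s))) (ps, t) (ps, comb (inorder ?s))"
      by (rule creach.step[of GoLeft, rotated]) (simp add: t Node)
    moreover have "Suc (Suc (comb_cost ?s)) = comb_cost t"
      using t Node by simp
    moreover have "inorder ?s = inorder t"
      using t Node by simp
    ultimately show ?thesis by metis
  qed
qed

text \<open>The common right path serves as intermediate tree. With n nodes, flattening
  \<open>t\<close> takes at most 4n operations and reversing the flattening of \<open>t'\<close> at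
  most 3 * 4n, together 16n.\<close>

lemma creach_same_inorder:
  assumes "inorder t = inorder t'" "t \<noteq> Leaf" "t' \<noteq> Leaf"
  shows "creach (16 * size t) ([], t) ([], t')"
proof -
  have "creach (comb_cost t + 3 * comb_cost t') ([], t) ([], t')"
    using creach_trans[OF creach_comb[of t "[]"]] creach_reverse[OF creach_comb[of t' "[]"]] assms
    by simp
  moreover have "size t' = size t"
    using assms(1) by (metis length_inorder)
  ultimately show ?thesis
    using creach_mono comb_cost_le[of t] comb_cost_le[of t'] by fastforce
qed

lemma simulate_creach:
  assumes "creach n c c'" "snd c \<noteq> Leaf" "bst (finger lo hi c)"
  shows "\<exists>ys. splays_to (finger lo hi c) ys (8 * n) (finger lo hi c')"
  using assms
proof (induction rule: creach.induct)
  case (refl n c)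
  then show ?case using splays_to_mono[OF splays_to_refl] by blast
next
  case (step o1 c c' n c'')
  obtain ys where ys: "splays_to (finger lo hi c) ys (op_cost o1) (finger lo hi c')"
    using simulate_cstep step by blast
  have "snd c' \<noteq> Leaf" "bst (finger lo hi c')"
    using cstep_not_Leaf step(1,4,5) splays_to_bst ys(1) by blast+
  then obtain zs where "splays_to (finger lo hi c') zs (8 * n) (finger lo hi c'')"
    using step by blast
  then have "splays_to (finger lo hi c) (ys @ zs) (op_cost o1 + 8 * n) (finger lo hi c'')"
    using splays_to_trans ys step.prems(2) by blast
  moreover have "op_cost o1 + 8 * n \<le> 8 * Suc n"
    by (simp add: op_cost_def)
  ultimately show ?case using splays_to_mono by blast
qed

section \<open>The initial splays\<close>

lemma inorder_similar_splay_tree: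
  "inorder (similar_splay_tree T lo hi) = lo # inorder T @ [hi]"
proof -
  have "inorder (add_max hi t) = inorder t @ [hi]" for t :: "'a tree"
    by (induction hi t rule: add_max.induct) auto
  moreover have "inorder (add_min lo t) = lo # inorder t" for t :: "'a tree"
    by (induction lo t rule: add_min.induct) auto
  ultimately show ?thesis by (simp add: similar_splay_tree_def)
qed

text \<open>Splaying a node leaves the previous root at depth at most two.\<close>
lemma splay_up_old_root:
  obtains A' B' where "splay_up (ps @ [CR D r]) (Node A x B) = Node (Node D r A') x B'"
  | C p A' B' where "splay_up (ps @ [CR D r]) (Node A x B) = Node (Node (Node D r C) p A') x B'"
proof -
  let ?P = "\<lambda>t. (\<exists>A' B'. t = Node (Node D r A') x B') \<or>
      (\<exists>C p A' B'. t = Node (Node (Node D r C) p A') x B')"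
  have "?P (splay_up (ps @ [CR D r]) (Node A x B))"
  \<comment> \<open>Earlier double steps leave the final step \<open>CR D r\<close> alone until at
    most one other step remains. Then Zig or ZigZag puts \<open>r\<close> at depth one, and ZigZig
    at depth two.\<close>
  proof (induction ps "Node A x B" arbitrary: A B rule: splay_up.induct)
    case (2 d)
    then show ?case by (cases d) auto
  next
    case (3 d1 d2 ps)
    obtain A' B' where "zigzx d1 d2 (Node A x B) = Node A' x B'"
      by (cases d1; cases d2) auto
    then show ?case using 3 by simp
  qed auto
  then show ?thesis using that by blast
qed

lemma sorted_wrt_less_unique_split:
  fixes x :: "'a::linorder"
  assumes "sorted_wrt (<) (xs @ x # ys)" "xs @ x # ys = xs' @ x # ys'"
  shows "xs = xs' \<and> ys = ys'"
proof -
  have "x \<notin> set xs" "x \<notin> set ys"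
    using assms(1) by (auto simp: sorted_wrt_append)
  then show ?thesis using assms(2) by (simp add: append_Cons_eq_iff)
qed

text \<open>Splaying \<open>lo\<close> and then \<open>hi\<close> leaves \<open>hi\<close> at the
  root with no right child and \<open>lo\<close> at depth one or two with no left child. One more
  splay of a key between them makes \<open>lo\<close> and \<open>hi\<close> the roots of the two
  sides.\<close>

lemma splays_to_finger:
  assumes "bst S" "inorder S = lo # ks @ [hi]" "ks \<noteq> []"
  shows "\<exists>ys T0. splays_to S ys (2 * size S + 2) (finger lo hi ([], T0)) \<and>
           T0 \<noteq> Leaf \<and> inorder T0 = ks"
proof -
  have so: "sorted_wrt (<) (lo # ks @ [hi])"
    using assms(1,2) by (metis bst_iff_sorted_wrt_less)
  then have "lo < hi" by simp
  have mem: "lo \<in> set_tree S" "hi \<in> set_tree S"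
    using assms(2) by (metis in_set_conv_decomp append_Cons append_Nil set_inorder)+
  obtain D X where s1: "splays_to S [lo] (size S) (Node D lo X)"
    using splay_once[OF assms(1) mem(1)] .
  have i1: "inorder D @ lo # inorder X = lo # ks @ [hi]" and b1: "bst (Node D lo X)"
    using splays_to_inorder[OF s1 assms(1)] splays_to_bst[OF s1 assms(1)] assms(2) by auto
  have D: "D = Leaf" and X: "inorder X = ks @ [hi]"
    using sorted_wrt_less_unique_split[of "[]" lo "ks @ [hi]" "inorder D" "inorder X"] so i1 by auto
  have size1: "size (Node D lo X) = size S"
    using arg_cong[OF i1, of length] arg_cong[OF assms(2), of length] by simp
  have "hi \<in> set_tree X" using X by (metis in_set_conv_decomp set_inorder)
  then obtain ps A B where d: "descend hi [] X = (ps, Node A hi B)"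
    using b1 snd_descend[of X hi "[]"] by (cases "descend hi [] X") auto
  have sp: "splay hi (Node D lo X) = splay_up (ps @ [CR D lo]) (Node A hi B)"
    using d \<open>lo < hi\<close> descend_append[of hi "[]" "[CR D lo]" X] by (auto simp: splay_def)
  define t2 where "t2 = splay hi (Node D lo X)"
  have s2: "splays_to (Node D lo X) [hi] (size S) t2"
    using \<open>hi \<in> set_tree X\<close> splay_cost_le_size[of hi "Node D lo X"] size1
    by (simp add: splays_to_def t2_def)
  have i2: "inorder t2 = lo # ks @ [hi]" and b2: "bst t2"
    using splays_to_inorder[OF s2 b1] splays_to_bst[OF s2 b1] i1 by auto
  have hi_root: "B' = Leaf \<and> inorder Y = lo # ks" if "t2 = Node Y hi B'" for Y B'
    using sorted_wrt_less_unique_split[of "lo # ks" hi "[]" "inorder Y" "inorder B'"] so i2 that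
    by auto
  obtain x T0 where s3: "splays_to t2 [x] 2 (finger lo hi ([], T0))"
    and T0: "T0 \<noteq> Leaf" "inorder T0 = ks"
  proof (cases rule: splay_up_old_root[of ps D lo A hi B])
    case (1 A' B')
    then have t2: "t2 = Node (Node D lo A') hi B'" using sp t2_def by simp
    with hi_root have e: "B' = Leaf" "inorder A' = ks" using D by auto
    \<comment> \<open>With \<open>lo\<close> at depth one, the root \<open>x\<close> of its right
      subtree is lifted by a ZigZag.\<close>
    then obtain A1 x A2 where A': "A' = Node A1 x A2" using assms(3) by (cases A') auto
    have "lo < x" "x < hi" using b2 t2 A' by auto
    then have "splays_to t2 [x] 2 (finger lo hi ([], A'))"
      using t2 e D A' by (auto simp: splays_to_def splay_def splay_cost_def)
    then show ?thesis using that e A' by blast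
  next
    case (2 C p A' B')
    then have t2: "t2 = Node (Node (Node D lo C) p A') hi B'" using sp t2_def by simp
    with hi_root have e: "B' = Leaf" "inorder (Node C p A') = ks" using D by auto
    \<comment> \<open>With \<open>lo\<close> at depth two, a Zig at its parent \<open>p\<close>
      suffices.\<close>
    have "p < hi" using b2 t2 by auto
    then have "splays_to t2 [p] 2 (finger lo hi ([], Node C p A'))"
      using t2 e D by (auto simp: splays_to_def splay_def splay_cost_def)
    then show ?thesis using that e by blast
  qed
  have "splays_to S ([lo] @ [hi] @ [x]) (size S + (size S + 2)) (finger lo hi ([], T0))"
    using splays_to_trans[OF s1 splays_to_trans[OF s2 s3 b1] assms(1)] .
  then show ?thesis using T0 by (metis mult_2 add.assoc)
qed

section \<open>The complete augmented sequence and the final bound\<close>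

lemma simulate_all:
  fixes T :: "'a::linorder tree"
  assumes "bst T" "\<forall>y\<in>set_tree T. lo < y \<and> y < hi" "valid_exec T xs oss" "T \<noteq> Leaf"
  defines "S \<equiv> similar_splay_tree T lo hi"
  shows "bst S \<and> (\<exists>ys. set ys \<subseteq> set_tree S \<and> subseq xs ys \<and>
           splay_seq_cost S ys \<le> 136 * (size T + num_rotations oss + num_moves oss))"
proof -
  have iS: "inorder S = lo # inorder T @ [hi]"
    unfolding S_def by (rule inorder_similar_splay_tree)
  obtain y where "y \<in> set_tree T" using assms(4) by (cases T) auto
  with assms(2) have "lo < hi" by (meson less_trans)
  with assms(1,2) iS have "sorted_wrt (<) (inorder S)"
    by (auto simp: bst_iff_sorted_wrt_less sorted_wrt_append)
  then have bS: "bst S" by (simp add: bst_iff_sorted_wrt_less)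
  have sz: "size S = size T + 2" "size T \<ge> 1"
    using arg_cong[OF iS, of length] assms(4) by (simp, cases T, auto)
  have "inorder T \<noteq> []" using assms(4) by (cases T) auto
  then obtain us T0 where us: "splays_to S us (2 * size S + 2) (finger lo hi ([], T0))"
    and T0: "T0 \<noteq> Leaf" "inorder T0 = inorder T"
    using splays_to_finger[OF bS iS] by blast
  have b0: "bst (finger lo hi ([], T0))" using splays_to_bst[OF us bS] .
  have "size T0 = size T" using T0(2) by (metis length_inorder)
  then have "creach (16 * size T) ([], T0) ([], T)"
    using creach_same_inorder[OF T0(2,1) assms(4)] by simp
  then obtain vs where
    vs: "splays_to (finger lo hi ([], T0)) vs (8 * (16 * size T)) (finger lo hi ([], T))"
    using simulate_creach[of "16 * size T" "([], T0)" "([], T)" lo hi] T0(1) b0 by auto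
  obtain ws t' where ws: "subseq xs ws"
    "splays_to (finger lo hi ([], T)) ws (8 * (num_rotations oss + num_moves oss)) t'"
    using simulate_exec[OF assms(3,4) splays_to_bst[OF vs b0]] by (auto simp: sum_op_cost)
  have "splays_to S (us @ vs @ ws) (2 * size S + 2 +
      (8 * (16 * size T) + 8 * (num_rotations oss + num_moves oss))) t'"
    using splays_to_trans[OF us splays_to_trans[OF vs ws(2) b0] bS] .
  moreover have "subseq xs (us @ vs @ ws)"
    using ws(1) by (simp add: list_emb_append2)
  \<comment> \<open>For n = \<open>size T\<close> the initial splays cost at most 2(n + 2) + 2 \<le>
    8n because n \<ge> 1. Adding 8 * 16n for the change of tree gives 136n.\<close>
  ultimately show ?thesis
    using bS sz unfolding splays_to_def by (intro conjI exI[of _ "us @ vs @ ws"]) auto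
qed

theorem theorem4p6:
  fixes key_type :: "'a::linorder itself"
  assumes rap: "regular_access_property key_type"
  shows "\<exists>C::real. \<forall>(T::'a tree) (lo::'a) hi xs oss.
           bst T \<longrightarrow> (\<forall>y\<in>set_tree T. lo < y \<and> y < hi) \<longrightarrow>
           set xs \<subseteq> set_tree T \<longrightarrow>
           valid_exec T xs oss \<longrightarrow>
           (\<forall>oss'. valid_exec T xs oss' \<longrightarrow>
              num_rotations oss + num_moves oss \<le> num_rotations oss' + num_moves oss') \<longrightarrow>
           real (splay_seq_cost (similar_splay_tree T lo hi) xs)
             \<le> C * real (size T + num_rotations oss + num_moves oss)"
proof -
  obtain k :: real where k: "\<And>(t::'a tree) xs ys. bst t \<Longrightarrow> set ys \<subseteq> set_tree t \<Longrightarrow> subseq xs ys \<Longrightarrow>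
      real (splay_seq_cost t xs) \<le> k * real (splay_seq_cost t ys)"
    using rap unfolding regular_access_property_def by blast
  have "real (splay_seq_cost (similar_splay_tree T lo hi) xs)
      \<le> \<bar>k\<bar> * 136 * real (size T + num_rotations oss + num_moves oss)"
    if T: "bst T" "\<forall>y\<in>set_tree T. lo < y \<and> y < hi" and xs: "set xs \<subseteq> set_tree T"
      and ex: "valid_exec T xs oss"
    for T :: "'a tree" and lo hi xs oss
  proof (cases "T = Leaf")
    \<comment> \<open>The simulation needs a cursor node; an empty tree admits no queries, so the
      cost is 0.\<close>
    case True
    then show ?thesis using xs by simp
  next
    case False
    let ?S = "similar_splay_tree T lo hi" and ?N = "size T + num_rotations oss + num_moves oss"
    obtain ys where ys: "bst ?S" "set ys \<subseteq> set_tree ?S" "subseq xs ys"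
      "splay_seq_cost ?S ys \<le> 136 * ?N"
      using simulate_all[OF T ex False] by blast
    have "real (splay_seq_cost ?S xs) \<le> k * real (splay_seq_cost ?S ys)"
      using k ys(1-3) by blast
    \<comment> \<open>The constant \<open>k\<close> of the property may be negative, hence the
      absolute value before enlarging the cost.\<close>
    also have "\<dots> \<le> \<bar>k\<bar> * real (splay_seq_cost ?S ys)"
      by (intro mult_right_mono) auto
    also have "\<dots> \<le> \<bar>k\<bar> * real (136 * ?N)"
      using ys(4) by (intro mult_left_mono of_nat_mono) auto
    finally show ?thesis by (simp add: algebra_simps)
  qed
  then show ?thesis by blast
qed

end
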